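(* Let $\mathcal{G}$ be a groupoid and let $R$ be a $\mathcal{G}$-graded ring which is object unital, with $1_{R_e}\neq 0$ for all $e\in\mathcal{G}_0$. Then the following are equivalent: (i) $R$ is strongly $\mathcal{G}$-graded; (ii) for all finite subsets $E$ of $\mathcal{G}_0$ the ring $R_{\mathcal{G}(E)}$ is strongly $\mathcal{G}(E)$-graded; (iii) for all $\sigma\in\mathcal{G}$ the equality $R_{r(\sigma)}=R_\sigma R_{\sigma^{-1}}$ holds; (iv) for all $\sigma\in\mathcal{G}$ the relation $1_{R_{r(\sigma)}}\in R_\sigma R_{\sigma^{-1}}$ holds.
   Context: Rings are associative but not necessarily unital. A groupoid $\mathcal{G}$ is a small category in which every morphism is an isomorphism, identified with its set of morphisms; $d(\sigma)=\sigma^{-1}\sigma$, $r(\sigma)=\sigma\sigma^{-1}$; $\mathcal{G}_0$ is the set of identity elements; $\sigma\tau$ is defined iff $d(\sigma)=r(\tau)$; $\mathcal{G}_2$ is the set of composable pairs. For subsets $X,Y$ of a ring, $XY$ is the set of finite sums of products $xy$, $x\in X$, $y\in Y$. A ring $R$ is $\mathcal{G}$-graded if $R=\bigoplus_{\sigma\in\mathcal{G}}R_\sigma$ for additive subgroups $R_\sigma$ with $R_\sigma R_\tau\subseteq R_{\sigma\tau}$ if $(\sigma,\tau)\in\mathcal{G}_2$ and $R_\sigma R_\tau=\{0\}$ otherwise. It is strongly graded if $R_\sigma R_\tau=R_{\sigma\tau}$ for all $(\sigma,\tau)\in\mathcal{G}_2$. It is object unital if each ring $R_e$, $e\in\mathcal{G}_0$,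 is unital and $1_{R_{r(\sigma)}}x=x1_{R_{d(\sigma)}}=x$ for all $\sigma\in\mathcal{G}$ and $x\in R_\sigma$. For $E\subseteq\mathcal{G}_0$, $\mathcal{G}(E)=\{\sigma\in\mathcal{G}\mid d(\sigma)\in E,\ r(\sigma)\in E\}$, and $R_{\mathcal{G}(E)}=\bigoplus_{\sigma\in\mathcal{G}(E)}R_\sigma$, which is $\mathcal{G}(E)$-graded. *)

theory Defs
  imports Main
begin

section \<open>Groupoids\<close>

text \<open>
  Small categories in the arrows-only presentation: objects are identified with their identity
  arrows, so \<open>source\<close> and \<open>target\<close> return arrows. The composite \<open>\<sigma> \<cdot> \<tau>\<close> is only meaningful if
  \<open>source \<sigma> = target \<tau>\<close>; its value on other arguments is unconstrained.
\<close>

record 'g arrow_category =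
  arrows :: "'g set"
  cmp :: "'g \<Rightarrow> 'g \<Rightarrow> 'g"  (infixl \<open>\<cdot>\<index>\<close> 70)
  source :: "'g \<Rightarrow> 'g"
  target :: "'g \<Rightarrow> 'g"

locale small_category =
  fixes G :: "('g, 'm) arrow_category_scheme" (structure)
  assumes source_closed: "\<sigma> \<in> arrows G \<Longrightarrow> source G \<sigma> \<in> arrows G"
    and target_closed: "\<sigma> \<in> arrows G \<Longrightarrow> target G \<sigma> \<in> arrows G"
    and source_source: "\<sigma> \<in> arrows G \<Longrightarrow> source G (source G \<sigma>) = source G \<sigma>"
    and target_source: "\<sigma> \<in> arrows G \<Longrightarrow> target G (source G \<sigma>) = source G \<sigma>"
    and source_target: "\<sigma> \<in> arrows G \<Longrightarrow> source G (target G \<sigma>) = target G \<sigma>"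
    and target_target: "\<sigma> \<in> arrows G \<Longrightarrow> target G (target G \<sigma>) = target G \<sigma>"
    and cmp_closed:
      "\<lbrakk>\<sigma> \<in> arrows G; \<tau> \<in> arrows G; source G \<sigma> = target G \<tau>\<rbrakk> \<Longrightarrow> \<sigma> \<cdot> \<tau> \<in> arrows G"
    and source_cmp:
      "\<lbrakk>\<sigma> \<in> arrows G; \<tau> \<in> arrows G; source G \<sigma> = target G \<tau>\<rbrakk>
        \<Longrightarrow> source G (\<sigma> \<cdot> \<tau>) = source G \<tau>"
    and target_cmp:
      "\<lbrakk>\<sigma> \<in> arrows G; \<tau> \<in> arrows G; source G \<sigma> = target G \<tau>\<rbrakk>
        \<Longrightarrow> target G (\<sigma> \<cdot> \<tau>) = target G \<sigma>"
    and cmp_assoc: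
      "\<lbrakk>\<sigma> \<in> arrows G; \<tau> \<in> arrows G; \<rho> \<in> arrows G;
        source G \<sigma> = target G \<tau>; source G \<tau> = target G \<rho>\<rbrakk>
        \<Longrightarrow> (\<sigma> \<cdot> \<tau>) \<cdot> \<rho> = \<sigma> \<cdot> (\<tau> \<cdot> \<rho>)"
    and cmp_source: "\<sigma> \<in> arrows G \<Longrightarrow> \<sigma> \<cdot> source G \<sigma> = \<sigma>"
    and target_cmp_self: "\<sigma> \<in> arrows G \<Longrightarrow> target G \<sigma> \<cdot> \<sigma> = \<sigma>"

definition is_inverse :: "('g, 'm) arrow_category_scheme \<Rightarrow> 'g \<Rightarrow> 'g \<Rightarrow> bool" where
  "is_inverse G \<sigma> \<tau> \<longleftrightarrow> \<tau> \<in> arrows G \<and> source G \<tau> = target G \<sigma> \<and> target G \<tau> = source G \<sigma> \<and>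
     \<tau> \<cdot>\<^bsub>G\<^esub> \<sigma> = source G \<sigma> \<and> \<sigma> \<cdot>\<^bsub>G\<^esub> \<tau> = target G \<sigma>"

locale groupoid = small_category +
  assumes ex_inverse: "\<sigma> \<in> arrows G \<Longrightarrow> \<exists>\<tau>. is_inverse G \<sigma> \<tau>"

definition ginv :: "('g, 'm) arrow_category_scheme \<Rightarrow> 'g \<Rightarrow> 'g" where
  "ginv G \<sigma> = (THE \<tau>. is_inverse G \<sigma> \<tau>)"

definition identities :: "('g, 'm) arrow_category_scheme \<Rightarrow> 'g set" where
  "identities G = {e \<in> arrows G. source G e = e}"

definition full_subgroupoid ::
    "('g, 'm) arrow_category_scheme \<Rightarrow> 'g set \<Rightarrow> ('g, 'm) arrow_category_scheme" where
  "full_subgroupoid G E =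
     G\<lparr>arrows := {\<sigma> \<in> arrows G. source G \<sigma> \<in> E \<and> target G \<sigma> \<in> E}\<rparr>"

context groupoid
begin

lemma is_inverse_unique:
  assumes "\<sigma> \<in> arrows G" "is_inverse G \<sigma> \<tau>" "is_inverse G \<sigma> \<rho>"
  shows "\<tau> = \<rho>"
proof -
  have "\<tau> = \<tau> \<cdot> (\<sigma> \<cdot> \<rho>)"
    using assms cmp_source[of \<tau>] by (simp add: is_inverse_def)
  also have "\<dots> = (\<tau> \<cdot> \<sigma>) \<cdot> \<rho>"
    using assms cmp_assoc[of \<tau> \<sigma> \<rho>] by (simp add: is_inverse_def)
  also have "\<dots> = \<rho>"
    using assms target_cmp_self[of \<rho>] by (simp add: is_inverse_def)
  finally show ?thesis .
qed

lemma is_inverse_ginv: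
  assumes "\<sigma> \<in> arrows G"
  shows "is_inverse G \<sigma> (ginv G \<sigma>)"
  unfolding ginv_def
  by (rule theI') (use assms ex_inverse is_inverse_unique in blast)

lemma
  assumes "\<sigma> \<in> arrows G"
  shows ginv_closed: "ginv G \<sigma> \<in> arrows G"
    and source_ginv: "source G (ginv G \<sigma>) = target G \<sigma>"
    and target_ginv: "target G (ginv G \<sigma>) = source G \<sigma>"
    and ginv_cmp: "ginv G \<sigma> \<cdot> \<sigma> = source G \<sigma>"
    and cmp_ginv: "\<sigma> \<cdot> ginv G \<sigma> = target G \<sigma>"
  using is_inverse_ginv[OF assms] by (auto simp: is_inverse_def)

lemma identities_eq_source_image: "identities G = source G ` arrows G"
  by (force simp: identities_def source_closed source_source)

lemma groupoid_full_subgroupoid: "groupoid (full_subgroupoid G E)"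
proof (unfold_locales, goal_cases)
  case (13 \<sigma>)
  then have "\<sigma> \<in> arrows G" by (simp add: full_subgroupoid_def)
  from is_inverse_ginv[OF this] 13 have "is_inverse (full_subgroupoid G E) \<sigma> (ginv G \<sigma>)"
    by (auto simp: is_inverse_def full_subgroupoid_def)
  then show ?case ..
qed (simp_all add: full_subgroupoid_def source_closed target_closed source_source target_source
      source_target target_target cmp_closed source_cmp target_cmp cmp_assoc cmp_source
      target_cmp_self)

end

section \<open>Rings graded by groupoids\<close>

text \<open>
  Rings, not necessarily unital, are subrings of a type of class \<open>ring\<close>; this class requires
  neither a unit nor commutativity of multiplication.
\<close>

definition add_subgroup :: "'a::ring set \<Rightarrow> bool" where
  "add_subgroup X \<longleftrightarrow> 0 \<in> X \<and> (\<forall>x\<in>X. \<forall>y\<in>X. x + y \<in> X) \<and> (\<forall>x\<in>X. - x \<in> X)"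

definition is_subring :: "'a::ring set \<Rightarrow> bool" where
  "is_subring X \<longleftrightarrow> add_subgroup X \<and> (\<forall>x\<in>X. \<forall>y\<in>X. x * y \<in> X)"

definition set_prod :: "'a::ring set \<Rightarrow> 'a set \<Rightarrow> 'a set" where
  "set_prod X Y = {\<Sum>i<n. x i * y i | (n::nat) x y. \<forall>i<n. x i \<in> X \<and> y i \<in> Y}"

definition sum_of_subgroups :: "'i set \<Rightarrow> ('i \<Rightarrow> 'a::ring set) \<Rightarrow> 'a set" where
  "sum_of_subgroups I S = {\<Sum>i\<in>F. x i | F x. finite F \<and> F \<subseteq> I \<and> (\<forall>i\<in>F. x i \<in> S i)}"

definition independent_subgroups :: "'i set \<Rightarrow> ('i \<Rightarrow> 'a::ring set) \<Rightarrow> bool" where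
  "independent_subgroups I S \<longleftrightarrow>
     (\<forall>F x. finite F \<and> F \<subseteq> I \<and> (\<forall>i\<in>F. x i \<in> S i) \<and> (\<Sum>i\<in>F. x i) = 0 \<longrightarrow> (\<forall>i\<in>F. x i = 0))"

definition is_direct_sum :: "'a::ring set \<Rightarrow> 'i set \<Rightarrow> ('i \<Rightarrow> 'a set) \<Rightarrow> bool" where
  "is_direct_sum A I S \<longleftrightarrow>
     (\<forall>i\<in>I. add_subgroup (S i)) \<and> A = sum_of_subgroups I S \<and> independent_subgroups I S"

locale groupoid_graded_ring = groupoid G
  for G :: "('g, 'm) arrow_category_scheme" (structure) +
  fixes A :: "'a::ring set" and S :: "'g \<Rightarrow> 'a set"
  assumes subring: "is_subring A"
    and direct_sum: "is_direct_sum A (arrows G) S"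
    and prod_subset:
      "\<lbrakk>\<sigma> \<in> arrows G; \<tau> \<in> arrows G; source G \<sigma> = target G \<tau>\<rbrakk>
        \<Longrightarrow> set_prod (S \<sigma>) (S \<tau>) \<subseteq> S (\<sigma> \<cdot> \<tau>)"
    and prod_zero:
      "\<lbrakk>\<sigma> \<in> arrows G; \<tau> \<in> arrows G; source G \<sigma> \<noteq> target G \<tau>\<rbrakk>
        \<Longrightarrow> set_prod (S \<sigma>) (S \<tau>) = {0}"

locale strongly_groupoid_graded_ring = groupoid_graded_ring +
  assumes prod_eq:
    "\<lbrakk>\<sigma> \<in> arrows G; \<tau> \<in> arrows G; source G \<sigma> = target G \<tau>\<rbrakk>
      \<Longrightarrow> set_prod (S \<sigma>) (S \<tau>) = S (\<sigma> \<cdot> \<tau>)"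

definition is_one :: "'a::ring set \<Rightarrow> 'a \<Rightarrow> bool" where
  "is_one X u \<longleftrightarrow> u \<in> X \<and> (\<forall>x\<in>X. u * x = x \<and> x * u = x)"

definition unital :: "'a::ring set \<Rightarrow> bool" where
  "unital X \<longleftrightarrow> (\<exists>u. is_one X u)"

definition one_of :: "'a::ring set \<Rightarrow> 'a" where
  "one_of X = (THE u. is_one X u)"

lemma one_of_eq: "is_one X u \<Longrightarrow> one_of X = u"
  unfolding one_of_def by (rule the_equality, assumption) (metis is_one_def)

lemma is_one_one_of: "unital X \<Longrightarrow> is_one X (one_of X)"
  using one_of_eq by (auto simp: unital_def)

definition object_unital ::
    "('g, 'm) arrow_category_scheme \<Rightarrow> ('g \<Rightarrow> 'a::ring set) \<Rightarrow> bool" where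
  "object_unital G S \<longleftrightarrow>
     (\<forall>e\<in>identities G. unital (S e)) \<and>
     (\<forall>\<sigma>\<in>arrows G. \<forall>x\<in>S \<sigma>. one_of (S (target G \<sigma>)) * x = x \<and> x * one_of (S (source G \<sigma>)) = x)"

end

theory Submission
  imports Defs
begin

text \<open>
  The only implication with content is that units suffice: if
  \<open>1 = \<Sum> a\<^sub>i b\<^sub>i\<close> is the unit at the target of \<open>\<sigma>\<close>, with \<open>a\<^sub>i\<close> of degree \<open>\<sigma>\<close> and \<open>b\<^sub>i\<close> of degree
  \<open>\<sigma>\<^sup>-\<^sup>1\<close>, then every \<open>x\<close> of degree \<open>\<sigma>\<tau>\<close> equals \<open>\<Sum> a\<^sub>i (b\<^sub>i x)\<close>, where \<open>b\<^sub>i x\<close> has degree \<open>\<tau>\<close>. Strong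
  gradedness is local, since the condition for a composable pair only involves the at most three
  objects at its ends.
\<close>

lemma mem_set_prod_iff:
  "z \<in> set_prod X Y \<longleftrightarrow> (\<exists>(n::nat) x y. z = (\<Sum>i<n. x i * y i) \<and> (\<forall>i<n. x i \<in> X \<and> y i \<in> Y))"
  unfolding set_prod_def by blast

lemma set_prodI:
  assumes "x \<in> X" "y \<in> Y"
  shows "x * y \<in> set_prod X Y"
  unfolding mem_set_prod_iff
proof (intro exI conjI)
  \<comment> \<open>A single product is a sum of length one with constant families; the bound
    \<open>Suc 0\<close> lets \<open>sum.lessThan_Suc\<close> unfold it.\<close>
  show "x * y = (\<Sum>i<Suc 0. x * y)"
    by (subst sum.lessThan_Suc) simp
qed (use assms in simp)

lemma sum_of_subgroupsI:
  assumes "finite F" "F \<subseteq> I" "\<And>i. i \<in> F \<Longrightarrow> x i \<in> S i"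
  shows "(\<Sum>i\<in>F. x i) \<in> sum_of_subgroups I S"
  unfolding sum_of_subgroups_def using assms by blast

lemma sum_of_subgroupsE:
  assumes "z \<in> sum_of_subgroups I S"
  obtains F x where "finite F" "F \<subseteq> I" "\<forall>i\<in>F. x i \<in> S i" "z = (\<Sum>i\<in>F. x i)"
  using assms unfolding sum_of_subgroups_def by blast

lemma subset_sum_of_subgroups: "i \<in> I \<Longrightarrow> S i \<subseteq> sum_of_subgroups I S"
proof
  fix x assume "i \<in> I" "x \<in> S i"
  then show "x \<in> sum_of_subgroups I S"
    using sum_of_subgroupsI[of "{i}" I "\<lambda>_. x" S] by simp
qed

lemma independent_subgroups_mono:
  assumes "independent_subgroups J S" "I \<subseteq> J"
  shows "independent_subgroups I S"
  unfolding independent_subgroups_def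
proof (intro allI impI)
  fix F x
  assume "finite F \<and> F \<subseteq> I \<and> (\<forall>i\<in>F. x i \<in> S i) \<and> (\<Sum>i\<in>F. x i) = 0"
  then show "\<forall>i\<in>F. x i = 0"
    using assms(1)[unfolded independent_subgroups_def, THEN spec, THEN spec, of F x] assms(2)
    by (simp add: subset_trans[of F I J])
qed

lemma add_subgroup_sum_of_subgroups:
  assumes sub: "\<And>i. i \<in> I \<Longrightarrow> add_subgroup (S i)"
  shows "add_subgroup (sum_of_subgroups I S)"
  unfolding add_subgroup_def
proof (intro conjI ballI)
  show "0 \<in> sum_of_subgroups I S"
    using sum_of_subgroupsI[of "{}" I "\<lambda>_. 0" S] by simp
next
  fix a b assume a: "a \<in> sum_of_subgroups I S" and b: "b \<in> sum_of_subgroups I S"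
  from a obtain F x where F: "finite F" "F \<subseteq> I" "\<forall>i\<in>F. x i \<in> S i" "a = (\<Sum>i\<in>F. x i)"
    by (rule sum_of_subgroupsE)
  from b obtain H y where H: "finite H" "H \<subseteq> I" "\<forall>i\<in>H. y i \<in> S i" "b = (\<Sum>i\<in>H. y i)"
    by (rule sum_of_subgroupsE)
  \<comment> \<open>Padding both families with zeros lets the two sums run over the common index set
    \<open>F \<union> H\<close>; the padded values stay in \<open>S i\<close> because a subgroup
    contains 0.\<close>
  let ?x = "\<lambda>i. if i \<in> F then x i else 0" and ?y = "\<lambda>i. if i \<in> H then y i else 0"
  have "a = (\<Sum>i\<in>F \<union> H. ?x i)" "b = (\<Sum>i\<in>F \<union> H. ?y i)"
    unfolding F(4) H(4) using F(1) H(1) by (auto intro!: sum.mono_neutral_cong_left)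
  then have "a + b = (\<Sum>i\<in>F \<union> H. ?x i + ?y i)"
    by (simp add: sum.distrib)
  also have "\<dots> \<in> sum_of_subgroups I S"
  proof (rule sum_of_subgroupsI)
    fix i assume "i \<in> F \<union> H"
    then have "add_subgroup (S i)" using F(2) H(2) sub by blast
    then show "?x i + ?y i \<in> S i"
      using F(3) H(3) by (simp add: add_subgroup_def)
  qed (use F H in auto)
  finally show "a + b \<in> sum_of_subgroups I S" .
next
  fix a assume "a \<in> sum_of_subgroups I S"
  then obtain F x where F: "finite F" "F \<subseteq> I" "\<forall>i\<in>F. x i \<in> S i" "a = (\<Sum>i\<in>F. x i)"
    by (rule sum_of_subgroupsE)
  have "- a = (\<Sum>i\<in>F. - x i)" by (simp add: F(4) sum_negf)
  also have "\<dots> \<in> sum_of_subgroups I S"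
  proof (rule sum_of_subgroupsI)
    fix i assume "i \<in> F"
    then show "- x i \<in> S i"
      using F(2) F(3) sub[of i] by (auto simp: add_subgroup_def)
  qed (use F in auto)
  finally show "- a \<in> sum_of_subgroups I S" .
qed

lemma add_subgroup_sum:
  assumes "add_subgroup X" "\<And>i. i \<in> F \<Longrightarrow> x i \<in> X"
  shows "(\<Sum>i\<in>F. x i) \<in> X"
  using assms(2)
  \<comment> \<open>For infinite \<open>F\<close> the sum is 0 by convention, which again lies in
    \<open>X\<close>.\<close>
  by (induction F rule: infinite_finite_induct) (use assms(1) in \<open>auto simp: add_subgroup_def\<close>)

text \<open>By distributivity, closure under products only has to be tested on homogeneous factors.
  The premise \<open>mult\<close> asks for membership in the whole sum, not in one component, so
  that it also covers factors of non-composable degrees, whose product is 0.\<close>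

lemma is_subring_sum_of_subgroups:
  assumes sub: "\<And>i. i \<in> I \<Longrightarrow> add_subgroup (S i)"
    and mult: "\<And>i j x y. \<lbrakk>i \<in> I; j \<in> I; x \<in> S i; y \<in> S j\<rbrakk> \<Longrightarrow> x * y \<in> sum_of_subgroups I S"
  shows "is_subring (sum_of_subgroups I S)"
  unfolding is_subring_def
proof (intro conjI ballI)
  show group: "add_subgroup (sum_of_subgroups I S)"
    using sub by (rule add_subgroup_sum_of_subgroups)
  fix a b assume a: "a \<in> sum_of_subgroups I S" and b: "b \<in> sum_of_subgroups I S"
  from a obtain F x where F: "finite F" "F \<subseteq> I" "\<forall>i\<in>F. x i \<in> S i" "a = (\<Sum>i\<in>F. x i)"
    by (rule sum_of_subgroupsE)
  from b obtain H y where H: "finite H" "H \<subseteq> I" "\<forall>i\<in>H. y i \<in> S i" "b = (\<Sum>i\<in>H. y i)"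
    by (rule sum_of_subgroupsE)
  have "x i * y j \<in> sum_of_subgroups I S" if "i \<in> F" "j \<in> H" for i j
    by (rule mult[of i j]) (use that F(2,3) H(2,3) in auto)
  then have "(\<Sum>i\<in>F. \<Sum>j\<in>H. x i * y j) \<in> sum_of_subgroups I S"
    by (simp add: add_subgroup_sum[OF group])
  then show "a * b \<in> sum_of_subgroups I S"
    unfolding F(4) H(4) sum_product .
qed

lemma full_subgroupoid_simps [simp]:
  "arrows (full_subgroupoid G E) = {\<sigma> \<in> arrows G. source G \<sigma> \<in> E \<and> target G \<sigma> \<in> E}"
  "source (full_subgroupoid G E) = source G"
  "target (full_subgroupoid G E) = target G"
  "cmp (full_subgroupoid G E) = cmp G"
  by (simp_all add: full_subgroupoid_def)

context groupoid
begin

lemma source_in_identities: "\<sigma> \<in> arrows G \<Longrightarrow> source G \<sigma> \<in> identities G"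
  by (simp add: identities_def source_closed source_source)

lemma target_in_identities: "\<sigma> \<in> arrows G \<Longrightarrow> target G \<sigma> \<in> identities G"
  by (simp add: identities_def target_closed source_target)

end

context groupoid_graded_ring
begin

lemma add_subgroup_component: "\<sigma> \<in> arrows G \<Longrightarrow> add_subgroup (S \<sigma>)"
  using direct_sum by (simp add: is_direct_sum_def)

lemma mult_mem_component:
  assumes "\<sigma> \<in> arrows G" "\<tau> \<in> arrows G" "source G \<sigma> = target G \<tau>" "x \<in> S \<sigma>" "y \<in> S \<tau>"
  shows "x * y \<in> S (\<sigma> \<cdot> \<tau>)"
  using prod_subset[OF assms(1-3)] set_prodI[OF assms(4,5)] by blast

lemma mult_eq_zero:
  assumes "\<sigma> \<in> arrows G" "\<tau> \<in> arrows G" "source G \<sigma> \<noteq> target G \<tau>" "x \<in> S \<sigma>" "y \<in> S \<tau>"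
  shows "x * y = 0"
  using prod_zero[OF assms(1-3)] set_prodI[OF assms(4,5)] by blast

text \<open>Composition and components are inherited, so the grading laws restrict verbatim, and
  independence passes to fewer indices. What remains is that the partial sum is closed under
  products.\<close>

lemma graded_full_subgroupoid:
  "groupoid_graded_ring (full_subgroupoid G E)
     (sum_of_subgroups (arrows (full_subgroupoid G E)) S) S"
proof -
  let ?I = "arrows (full_subgroupoid G E)"
  have sub: "add_subgroup (S \<sigma>)" if "\<sigma> \<in> ?I" for \<sigma>
    using that add_subgroup_component by simp
  have ring: "is_subring (sum_of_subgroups ?I S)"
  proof (rule is_subring_sum_of_subgroups[OF sub])
    fix \<sigma> \<tau> x y assume *: "\<sigma> \<in> ?I" "\<tau> \<in> ?I" "x \<in> S \<sigma>" "y \<in> S \<tau>"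
    show "x * y \<in> sum_of_subgroups ?I S"
    proof (cases "source G \<sigma> = target G \<tau>")
      case True
      \<comment> \<open>The outer ends of a composite are ends of its factors, hence lie in
        \<open>E\<close>.\<close>
      with * have "\<sigma> \<cdot> \<tau> \<in> ?I" by (simp add: cmp_closed source_cmp target_cmp)
      moreover from True * have "x * y \<in> S (\<sigma> \<cdot> \<tau>)" by (intro mult_mem_component) simp_all
      ultimately show ?thesis using subset_sum_of_subgroups[of "\<sigma> \<cdot> \<tau>" ?I S] by blast
    next
      case False
      with * have "x * y = 0" by (intro mult_eq_zero) auto
      then show ?thesis
        using add_subgroup_sum_of_subgroups[of ?I S, OF sub] by (simp add: add_subgroup_def)
    qed
  qed
  have "independent_subgroups (arrows G) S"
    using direct_sum by (simp add: is_direct_sum_def)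
  moreover have "?I \<subseteq> arrows G" by auto
  ultimately have "independent_subgroups ?I S"
    by (rule independent_subgroups_mono)
  then have sum: "is_direct_sum (sum_of_subgroups ?I S) ?I S"
    using sub by (simp add: is_direct_sum_def)
  show ?thesis
  proof (rule groupoid_graded_ring.intro[OF groupoid_full_subgroupoid], unfold_locales)
    show "is_subring (sum_of_subgroups ?I S)" by (fact ring)
    show "is_direct_sum (sum_of_subgroups ?I S) ?I S" by (fact sum)
  qed (use prod_subset prod_zero in simp_all)
qed

text \<open>The reverse inclusion is already part of being graded.\<close>

lemma strongly_gradedI:
  assumes "\<And>\<sigma> \<tau>. \<lbrakk>\<sigma> \<in> arrows G; \<tau> \<in> arrows G; source G \<sigma> = target G \<tau>\<rbrakk>
    \<Longrightarrow> S (\<sigma> \<cdot> \<tau>) \<subseteq> set_prod (S \<sigma>) (S \<tau>)"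
  shows "strongly_groupoid_graded_ring G A S"
  by unfold_locales (use assms prod_subset in blast)

lemma strongly_graded_iff_full_subgroupoids:
  "strongly_groupoid_graded_ring G A S \<longleftrightarrow>
     (\<forall>E. finite E \<and> E \<subseteq> identities G \<longrightarrow>
        strongly_groupoid_graded_ring (full_subgroupoid G E)
          (sum_of_subgroups (arrows (full_subgroupoid G E)) S) S)"
proof (intro iffI allI impI)
  fix E
  assume "strongly_groupoid_graded_ring G A S"
  then interpret strongly_groupoid_graded_ring G A S .
  show "strongly_groupoid_graded_ring (full_subgroupoid G E)
      (sum_of_subgroups (arrows (full_subgroupoid G E)) S) S"
    \<comment> \<open>A composable pair in the full subgroupoid is one in \<open>G\<close> with the
      same composite, so \<open>prod_eq\<close> for \<open>G\<close> applies to it.\<close>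
    by (intro strongly_groupoid_graded_ring.intro graded_full_subgroupoid
        strongly_groupoid_graded_ring_axioms.intro) (use prod_eq in auto)
next
  assume strong: "\<forall>E. finite E \<and> E \<subseteq> identities G \<longrightarrow>
    strongly_groupoid_graded_ring (full_subgroupoid G E)
      (sum_of_subgroups (arrows (full_subgroupoid G E)) S) S"
  show "strongly_groupoid_graded_ring G A S"
  proof (rule strongly_gradedI)
    fix \<sigma> \<tau> assume *: "\<sigma> \<in> arrows G" "\<tau> \<in> arrows G" "source G \<sigma> = target G \<tau>"
    \<comment> \<open>All objects at the ends of \<open>\<sigma>\<close> and \<open>\<tau>\<close>;
      \<open>source G \<sigma>\<close> is covered as it equals \<open>target G \<tau>\<close>. Both
      arrows thus lie in the full subgroupoid on \<open>?E\<close>.\<close>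
    let ?E = "{target G \<sigma>, target G \<tau>, source G \<tau>}"
    have "strongly_groupoid_graded_ring (full_subgroupoid G ?E)
        (sum_of_subgroups (arrows (full_subgroupoid G ?E)) S) S"
      by (rule strong[rule_format]) (use * source_in_identities target_in_identities in simp)
    from strongly_groupoid_graded_ring.prod_eq[OF this, of \<sigma> \<tau>] *
    show "S (\<sigma> \<cdot> \<tau>) \<subseteq> set_prod (S \<sigma>) (S \<tau>)" by simp
  qed
qed

lemma strongly_graded_of_units:
  assumes unital: "object_unital G S"
    and units: "\<And>\<sigma>. \<sigma> \<in> arrows G \<Longrightarrow>
      one_of (S (target G \<sigma>)) \<in> set_prod (S \<sigma>) (S (ginv G \<sigma>))"
  shows "strongly_groupoid_graded_ring G A S"
proof (intro strongly_gradedI subsetI)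
  fix \<sigma> \<tau> x
  assume *: "\<sigma> \<in> arrows G" "\<tau> \<in> arrows G" "source G \<sigma> = target G \<tau>" and x: "x \<in> S (\<sigma> \<cdot> \<tau>)"
  obtain n :: nat and a b where one: "one_of (S (target G \<sigma>)) = (\<Sum>i<n. a i * b i)"
    and ab: "\<And>i. i < n \<Longrightarrow> a i \<in> S \<sigma> \<and> b i \<in> S (ginv G \<sigma>)"
    using units[OF *(1)] unfolding mem_set_prod_iff by blast
  \<comment> \<open>The unit fixes \<open>x\<close> because \<open>\<sigma> \<cdot> \<tau>\<close>
    has the same target as \<open>\<sigma>\<close>.\<close>
  have "x = one_of (S (target G \<sigma>)) * x"
    using unital x * by (metis object_unital_def cmp_closed target_cmp)
  also have "\<dots> = (\<Sum>i<n. a i * (b i * x))"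
    by (simp add: one sum_distrib_right mult.assoc)
  finally have "x = (\<Sum>i<n. a i * (b i * x))" .
  moreover have "b i * x \<in> S \<tau>" if "i < n" for i
  proof -
    have "b i * x \<in> S (ginv G \<sigma> \<cdot> (\<sigma> \<cdot> \<tau>))"
      using that ab x * by (intro mult_mem_component)
        (auto simp: ginv_closed cmp_closed source_ginv target_cmp)
    \<comment> \<open>After reassociating, \<open>ginv G \<sigma> \<cdot> \<sigma>\<close> is the
      identity \<open>source G \<sigma> = target G \<tau>\<close>, which is absorbed by
      \<open>\<tau>\<close>.\<close>
    also have "ginv G \<sigma> \<cdot> (\<sigma> \<cdot> \<tau>) = \<tau>"
      using * cmp_assoc[of "ginv G \<sigma>" \<sigma> \<tau>]
      by (simp add: ginv_closed source_ginv ginv_cmp target_cmp_self)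
    finally show ?thesis .
  qed
  ultimately show "x \<in> set_prod (S \<sigma>) (S \<tau>)"
    \<comment> \<open>The second family, left to unification, is \<open>b i * x\<close>.\<close>
    unfolding mem_set_prod_iff using ab by (intro exI[of _ n] exI[of _ a] exI) auto
qed

end

theorem proposition7:
  fixes G :: "('g, 'm) arrow_category_scheme"
    and R :: "'a::ring set" and S :: "'g \<Rightarrow> 'a set"
  assumes "groupoid G"
    and "groupoid_graded_ring G R S"
    and "object_unital G S"
    and "\<forall>e\<in>identities G. one_of (S e) \<noteq> 0"
  shows "(strongly_groupoid_graded_ring G R S \<longleftrightarrow>
          (\<forall>E. finite E \<and> E \<subseteq> identities G \<longrightarrow>
             strongly_groupoid_graded_ring (full_subgroupoid G E)
               (sum_of_subgroups (arrows (full_subgroupoid G E)) S) S)) \<and>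
         (strongly_groupoid_graded_ring G R S \<longleftrightarrow>
          (\<forall>\<sigma>\<in>arrows G. S (target G \<sigma>) = set_prod (S \<sigma>) (S (ginv G \<sigma>)))) \<and>
         (strongly_groupoid_graded_ring G R S \<longleftrightarrow>
          (\<forall>\<sigma>\<in>arrows G. one_of (S (target G \<sigma>)) \<in> set_prod (S \<sigma>) (S (ginv G \<sigma>))))"
proof -
  interpret groupoid_graded_ring G R S by fact
  \<comment> \<open>(i) to (iii): strong gradedness for the pair \<open>\<sigma>\<close>,
    \<open>ginv G \<sigma>\<close>, whose composite is \<open>target G \<sigma>\<close>.\<close>
  have "S (target G \<sigma>) = set_prod (S \<sigma>) (S (ginv G \<sigma>))"
    if "strongly_groupoid_graded_ring G R S" "\<sigma> \<in> arrows G" for \<sigma>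
    using strongly_groupoid_graded_ring.prod_eq[OF that(1), of \<sigma> "ginv G \<sigma>"] that(2)
    by (simp add: ginv_closed target_ginv cmp_ginv)
  \<comment> \<open>(iii) to (iv): the target is an identity, so its component is unital and
    contains its unit.\<close>
  moreover have "one_of (S (target G \<sigma>)) \<in> S (target G \<sigma>)" if "\<sigma> \<in> arrows G" for \<sigma>
    using that \<open>object_unital G S\<close> target_in_identities is_one_one_of
    unfolding object_unital_def is_one_def by blast
  \<comment> \<open>(iv) to (i) closes the cycle; the equivalence with (ii) is joined
    separately.\<close>
  moreover note strongly_graded_of_units[OF \<open>object_unital G S\<close>]
  ultimately show ?thesis
    using strongly_graded_iff_full_subgroupoids by blast
qed

end
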